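(* Let $s\ge 2$ and $t$ be integers with $1\le t\le s-2$. Then the functions $\mathcal{F}_{s,t,r,n}$, where $r$ ranges over the integers distinguished with respect to $(s,t)$ and $n$ ranges over $\Upsilon_{s,t,r}$, span the complex vector space of all rational functions (with complex coefficients) that are fixed by $\phi_{s,t}$.
   Context: For integers $s,t$, $\phi_{s,t}$ maps a formal series $\sum_{n\in\mathbb{Z}}a_nx^n$ with complex coefficients to $\sum_{n\in\mathbb{Z}}a_{sn+t}x^n$. A rational function $R\in\mathbb{C}(x)$ is identified with its Laurent expansion at $x=0$, $\sum_{n\gg-\infty}a_nx^n$ (coefficients vanish for sufficiently negative $n$); $R$ is fixed by $\phi_{s,t}$ if $\phi_{s,t}(R)=R$ as formal series. For integers $r\ge1$ with $\gcd(r,s)=1$, $\operatorname{ord}_r(s)$ is the least positive $m$ with $s^m\equiv1\pmod r$; an integer $r\ge 2$ is distinguished with respect to $(s,t)$ if $\gcd(r,s)=1$ and $r$ divides $t\cdot\frac{s^{\operatorname{ord}_r(s)}-1}{s-1}$. For such $r$, let $\rho_{s,t}:\mathbb{Z}/r\mathbb{Z}\to\mathbb{Z}/r\mathbb{Z}$, $n\mapsto sn+t \bmod r$ (a bijection), and for $n\in\{0,\dots,r-1\}$ let $F_{s,t,r,n}=\{\rho_{s,t}^{(i)}(n)\bmod r : i\in\mathbb{Z}\}$, viewed as a subset of $\{0,\dots,r-1\}$, where $\rho^{(i)}$ is the $i$-th iterate. Let $\Upsilon_{s,t,r}\subseteq\{0,\dots,r-1\}$ be a complete set of representatives of these orbits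 (for each $n$ there is a unique $n'\in\Upsilon_{s,t,r}$ with $F_{s,t,r,n}=F_{s,t,r,n'}$). Define $\mathcal{F}_{s,t,r,n}(x)=\frac{1}{1-x^r}\sum_{j\in F_{s,t,r,n}}x^j$. *)

theory Defs
  imports
    "HOL-Computational_Algebra.Computational_Algebra"
    "HOL-Computational_Algebra.Field_as_Ring"
    "HOL-Number_Theory.Number_Theory"
begin

type_synonym ratfun = "complex poly fract"

abbreviation poly_to_fls :: "complex poly \<Rightarrow> complex fls" where
  "poly_to_fls p \<equiv> fps_to_fls (fps_of_poly p)"

text \<open>Laurent expansion at \<open>0\<close>; any representing fraction gives the same series.\<close>
definition laurent :: "ratfun \<Rightarrow> complex fls" where
  "laurent R = poly_to_fls (fst (quot_of_fract R)) / poly_to_fls (snd (quot_of_fract R))"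

lemma laurent_Fract:
  assumes "q \<noteq> 0"
  shows "laurent (Fract p q) = poly_to_fls p / poly_to_fls q"
proof -
  define x where "x = quot_of_fract (Fract p q)"
  have nz: "snd x \<noteq> 0" by (simp add: x_def)
  have "Fract (fst x) (snd x) = Fract p q"
    by (simp add: x_def Fract_quot_of_fract)
  then have eq: "fst x * q = p * snd x"
    using assms nz by (simp add: eq_fract)
  have "poly_to_fls (fst x) * poly_to_fls q = poly_to_fls p * poly_to_fls (snd x)"
    using eq by (metis fls_times_fps_to_fls fps_of_poly_mult)
  moreover have "poly_to_fls (snd x) \<noteq> 0" "poly_to_fls q \<noteq> 0"
    using nz assms by auto
  ultimately show ?thesis
    by (simp add: laurent_def frac_eq_eq flip: x_def)
qed

definition scale_ratfun :: "complex \<Rightarrow> ratfun \<Rightarrow> ratfun" where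
  "scale_ratfun c R = to_fract [:c:] * R"

interpretation ratfun: vector_space scale_ratfun
proof
  fix a b :: complex and x y :: ratfun
  show "scale_ratfun a (x + y) = scale_ratfun a x + scale_ratfun a y"
    by (simp add: scale_ratfun_def distrib_left)
  have "to_fract [:a + b:] = to_fract [:a:] + to_fract [:b:]"
    by (simp flip: to_fract_add)
  then show "scale_ratfun (a + b) x = scale_ratfun a x + scale_ratfun b x"
    by (simp add: scale_ratfun_def distrib_right)
  have "to_fract [:a * b:] = to_fract [:a:] * to_fract [:b:]"
    by (simp flip: to_fract_mult)
  then show "scale_ratfun a (scale_ratfun b x) = scale_ratfun (a * b) x"
    by (simp add: scale_ratfun_def mult.assoc)
  show "scale_ratfun 1 x = x"
    by (simp add: scale_ratfun_def flip: one_pCons)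
qed

definition phi :: "int \<Rightarrow> int \<Rightarrow> (int \<Rightarrow> complex) \<Rightarrow> (int \<Rightarrow> complex)" where
  "phi s t a = (\<lambda>n. a (s * n + t))"

definition fixed_by_phi :: "int \<Rightarrow> int \<Rightarrow> ratfun \<Rightarrow> bool" where
  "fixed_by_phi s t R \<longleftrightarrow> phi s t (fls_nth (laurent R)) = fls_nth (laurent R)"

text \<open>The division by \<open>s - 1\<close> is exact for \<open>s \<noteq> 1\<close>; \<open>s = 1\<close> gives \<open>0 div 0 = 0\<close>.\<close>
definition distinguished :: "int \<Rightarrow> int \<Rightarrow> int \<Rightarrow> bool" where
  "distinguished s t r \<longleftrightarrow> r \<ge> 2 \<and> coprime r s \<and> r dvd t * ((s ^ ord r s - 1) div (s - 1))"

text \<open>Residue classes modulo \<open>r\<close> are represented by \<open>{0..<r}\<close>.\<close>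
definition rho :: "int \<Rightarrow> int \<Rightarrow> int \<Rightarrow> int \<Rightarrow> int" where
  "rho s t r n = (s * n + t) mod r"

lemma bij_betw_rho:
  assumes "r \<ge> 1" "coprime r s"
  shows "bij_betw (rho s t r) {0..<r} {0..<r}"
proof -
  have "inj_on (rho s t r) {0..<r}"
  proof (rule inj_onI)
    fix x y assume xy: "x \<in> {0..<r}" "y \<in> {0..<r}" "rho s t r x = rho s t r y"
    then have "[s * x + t = s * y + t] (mod r)" by (simp add: rho_def cong_def)
    then have "[s * x = s * y] (mod r)" by (simp add: cong_add_rcancel)
    then have "[x = y] (mod r)" using assms by (simp add: cong_mult_lcancel coprime_commute)
    then show "x = y" using xy by (simp add: cong_def)
  qed
  moreover have "rho s t r ` {0..<r} \<subseteq> {0..<r}"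
    using assms by (auto simp: rho_def)
  ultimately show ?thesis
    by (simp add: bij_betw_def endo_inj_surj)
qed

definition rho_iter :: "int \<Rightarrow> int \<Rightarrow> int \<Rightarrow> int \<Rightarrow> int \<Rightarrow> int" where
  "rho_iter s t r i =
     (if i \<ge> 0 then rho s t r ^^ nat i else inv_into {0..<r} (rho s t r) ^^ nat (- i))"

definition orbit_set :: "int \<Rightarrow> int \<Rightarrow> int \<Rightarrow> int \<Rightarrow> int set" where
  "orbit_set s t r n = {rho_iter s t r i n | i. True}"

definition orbit_reps :: "int \<Rightarrow> int \<Rightarrow> int \<Rightarrow> int set \<Rightarrow> bool" where
  "orbit_reps s t r U \<longleftrightarrow> U \<subseteq> {0..<r} \<and>
     (\<forall>n\<in>{0..<r}. \<exists>!n'. n' \<in> U \<and> orbit_set s t r n = orbit_set s t r n')"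

definition orbit_fun :: "int \<Rightarrow> int \<Rightarrow> int \<Rightarrow> int \<Rightarrow> ratfun" where
  "orbit_fun s t r n =
     Fract (\<Sum>j\<in>orbit_set s t r n. Polynomial.monom 1 (nat j)) (1 - Polynomial.monom 1 (nat r))"

end

theory Submission
  imports Defs
begin

text \<open>
  Let \<open>R = \<Sum> a\<^sub>n x\<^sup>n\<close> be fixed. The map \<open>n \<mapsto> s n + t\<close> drives every negative \<open>n\<close> to \<open>-\<infinity>\<close>, so \<open>a\<^sub>n = 0\<close>
  for \<open>n < 0\<close>, and \<open>R = P / Q\<close> in lowest terms with \<open>Q(0) \<noteq> 0\<close>. Some power \<open>G\<close> of the product of
  \<open>x - z\<^sup>s\<close> over the roots \<open>z\<close> of \<open>Q\<close> satisfies \<open>Q dvd G(x\<^sup>s)\<close>; extracting the coefficients of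
  index \<open>s n + t\<close> shows that \<open>R G\<close> is a polynomial, so \<open>Q dvd G\<close>. Hence \<open>z \<mapsto> z\<^sup>s\<close> permutes the
  finite set of roots, and all of them are roots of unity of order dividing
  \<open>r = 1 + s + \<dots> + s\<^bsup>M-1\<^esup>\<close> for a suitable \<open>M\<close>. On each class modulo \<open>r\<close> the coefficients are
  therefore eventually polynomial in \<open>n\<close>; since the \<open>M\<close>-th iterate of \<open>n \<mapsto> s n + t\<close> increases \<open>n\<close>
  and preserves its class, each value is taken infinitely often, so these polynomials are constant
  and \<open>a\<close> is \<open>r\<close>-periodic on the naturals. As \<open>s\<close> has order \<open>M\<close> modulo \<open>r\<close>, this \<open>r\<close> is
  distinguished, and \<open>a\<close> is constant on the orbits modulo \<open>r\<close>.
\<close>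

section \<open>Finite permutations and geometric sums\<close>

text \<open>Pigeonhole on the iterates: restricted to \<open>Z\<close> they lie in a finite function
  space, so two of them agree there. Surjectivity writes \<open>z\<close> as
  \<open>(f ^^ i) y\<close>, which cancels the smaller exponent.\<close>

lemma finite_surj_periodic:
  assumes "finite Z" "f ` Z = Z"
  shows "\<exists>m>0. \<forall>z\<in>Z. (f ^^ m) z = z"
proof -
  have img: "(f ^^ k) ` Z = Z" for k
  proof (induction k)
    case (Suc k)
    have "(f ^^ Suc k) ` Z = f ` ((f ^^ k) ` Z)" by (simp add: image_comp)
    then show ?case using Suc assms(2) by simp
  qed simp
  define g where "g k = restrict (f ^^ k) Z" for k
  have "range g \<subseteq> Z \<rightarrow>\<^sub>E Z" using img by (fastforce simp: g_def)
  then have "finite (range g)"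
    using finite_PiE[OF assms(1), of "\<lambda>_. Z"] assms(1) finite_subset by blast
  then have "\<not> inj g" using finite_imageD infinite_UNIV_nat by blast
  then obtain i j where "g i = g j" "i < j" by (metis injI linorder_neqE_nat)
  show ?thesis
  proof (intro exI conjI ballI)
    show "j - i > 0" using \<open>i < j\<close> by simp
    fix z assume "z \<in> Z"
    then obtain y where y: "y \<in> Z" "z = (f ^^ i) y" using img[of i] by blast
    have "(f ^^ (j - i)) z = (f ^^ (j - i + i)) y" unfolding funpow_add y(2) by simp
    also have "\<dots> = g j y" using \<open>i < j\<close> y by (simp add: g_def)
    also have "\<dots> = z" using \<open>g i = g j\<close>[symmetric] y by (simp add: g_def)
    finally show "(f ^^ (j - i)) z = z" .
  qed
qed

lemma geometric_sum_nat:
  fixes s M :: nat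
  assumes "s \<ge> 1"
  shows "s ^ M = 1 + (s - 1) * (\<Sum>i<M. s ^ i)"
proof (induction M)
  case (Suc M)
  have "s * s ^ M = s ^ M + (s - 1) * s ^ M"
    using assms by (cases s) (simp_all)
  then show ?case using Suc by (simp add: algebra_simps)
qed simp

text \<open>Euler's theorem is applied modulo \<open>d * (s - 1)\<close> rather than
  \<open>d\<close>, so that the factor \<open>s - 1\<close> can be cancelled from
  \<open>s ^ k - 1\<close>.\<close>

lemma dvd_geometric_sum:
  fixes d s :: nat
  assumes "coprime d s" "d > 0" "s \<ge> 2"
  shows "\<exists>M\<ge>2. d dvd (\<Sum>i<M. s ^ i)"
proof -
  define e where "e = totient (d * (s - 1))"
  have pos: "e > 0" using assms by (simp add: e_def)
  have "coprime (s - 1) s"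
    using assms by (metis Suc_diff_1 coprime_Suc_right_nat less_le_trans pos2)
  then have "coprime s (d * (s - 1))" using assms by (simp add: coprime_commute)
  then have "[s ^ e = 1] (mod d * (s - 1))" unfolding e_def by (rule euler_theorem)
  \<comment> \<open>Squaring doubles the exponent, which guarantees that it is at least 2.\<close>
  then have "[(s ^ e) ^ 2 = 1 ^ 2] (mod d * (s - 1))" by (rule cong_pow)
  then have "[s ^ (2 * e) = 1] (mod d * (s - 1))" by (simp add: power_mult[symmetric] mult.commute)
  then have "d * (s - 1) dvd (s - 1) * (\<Sum>i<2*e. s ^ i)"
    using geometric_sum_nat[of s "2 * e"] assms
    by (metis One_nat_def add_diff_cancel_left' cong_to_1_nat le_trans one_le_numeral)
  then have "d dvd (\<Sum>i<2*e. s ^ i)" using assms by (simp add: mult.commute)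
  then show ?thesis using pos by (intro exI[of _ "2 * e"]) auto
qed

section \<open>Sections of power series and growth of coefficients\<close>

text \<open>The analogue of \<open>phi\<close> for power series, with natural indices.\<close>

definition section_fps :: "nat \<Rightarrow> nat \<Rightarrow> 'a fps \<Rightarrow> 'a fps" where
  "section_fps s t F = Abs_fps (\<lambda>n. fps_nth F (s * n + t))"

lemma coeff_pcompose_monom:
  fixes p :: "'a :: comm_ring_1 poly"
  assumes "s > 0"
  shows "Polynomial.coeff (p \<circ>\<^sub>p Polynomial.monom 1 s) i = (if s dvd i then Polynomial.coeff p (i div s) else 0)"
proof (induction p arbitrary: i)
  case (pCons a p)
  show ?case
  proof (cases "i < s")
    case True
    then show ?thesis using assms
      by (cases "i = 0") (auto simp: pcompose_pCons coeff_monom_mult coeff_pCons dest: dvd_imp_le split: nat.splits)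
  next
    case False
    then obtain k where "i = s + k" using le_Suc_ex not_less by blast
    then show ?thesis using assms
      by (simp add: pcompose_pCons coeff_monom_mult coeff_pCons pCons.IH split: nat.splits)
  qed
qed simp

text \<open>\<open>G(x^s)\<close> is supported on multiples of \<open>s\<close>, so only those
  indices contribute to the convolution. Because \<open>t < s\<close>, the multiples
  \<open>s * k\<close> up to \<open>s * n + t\<close> are exactly those with \<open>k\<close> at
  most \<open>n\<close>.\<close>

lemma section_fps_mult:
  fixes F :: "'a :: comm_ring_1 fps"
  assumes "t < s"
  shows "section_fps s t (F * fps_of_poly (G \<circ>\<^sub>p Polynomial.monom 1 s)) = section_fps s t F * fps_of_poly G"
proof (rule fps_ext)
  fix n
  have s: "s > 0" using assms by simp
  let ?D = "fps_of_poly (G \<circ>\<^sub>p Polynomial.monom 1 s)"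
  have "(\<Sum>i=0..s*n+t. fps_nth ?D i * fps_nth F (s*n+t-i)) =
     (\<Sum>i\<in>(\<lambda>i. s * i) ` {0..n}. fps_nth ?D i * fps_nth F (s*n+t-i))"
  proof (rule sum.mono_neutral_right)
    show "(\<lambda>i. s * i) ` {0..n} \<subseteq> {0..s*n+t}" by (auto intro!: trans_le_add1 mult_le_mono2)
    show "\<forall>i\<in>{0..s*n+t} - (\<lambda>i. s * i) ` {0..n}. fps_nth ?D i * fps_nth F (s*n+t-i) = 0"
    proof
      fix i assume i: "i \<in> {0..s*n+t} - (\<lambda>i. s * i) ` {0..n}"
      have "\<not> s dvd i"
      proof
        assume "s dvd i"
        then obtain k where k: "i = s * k" by blast
        have "s * k < s * (n + 1)" using i k assms by auto
        then have "k \<le> n" using s by (metis Suc_eq_plus1 less_Suc_eq_le mult_less_cancel1)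
        then show False using i k by auto
      qed
      then show "fps_nth ?D i * fps_nth F (s*n+t-i) = 0"
        using s by (simp add: coeff_pcompose_monom)
    qed
  qed simp
  also have "\<dots> = (\<Sum>i=0..n. Polynomial.coeff G i * fps_nth F (s*(n-i)+t))"
    using s by (subst sum.reindex) (auto simp: inj_on_def coeff_pcompose_monom diff_mult_distrib2 intro!: sum.cong)
  finally show "fps_nth (section_fps s t (F * ?D)) n = fps_nth (section_fps s t F * fps_of_poly G) n"
    by (simp add: section_fps_def fps_mult_nth mult.commute[of F] mult.commute[of "Abs_fps _"])
qed

text \<open>Multiplying by \<open>1 - fps_X ^ r\<close> takes differences along a residue class, so
  each induction step is a summation. In the basis \<open>j + l choose l\<close>, Pascal's rule
  makes summation a shift of \<open>l\<close>, with a new constant term \<open>K\<close>.\<close>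

lemma rational_fps_coeff_eventually_binomial:
  fixes F :: "'a :: comm_ring_1 fps"
  assumes "F * (1 - fps_X ^ r) ^ k = fps_of_poly N" "r > 0"
  shows "\<exists>w j0. \<forall>j\<ge>j0. fps_nth F (i + j * r) = (\<Sum>l<k. w l * of_nat (j + l choose l))"
  using assms(1)
proof (induction k arbitrary: F)
  case 0
  have "fps_nth F (i + j * r) = 0" if "j \<ge> Suc (Polynomial.degree N)" for j
  proof -
    have "j \<le> j * r" using assms(2) by simp
    then have "Polynomial.degree N < i + j * r" using that by linarith
    then show ?thesis using 0 by (simp add: coeff_eq_0)
  qed
  then show ?case by auto
next
  case (Suc k)
  have "(F * (1 - fps_X ^ r)) * (1 - fps_X ^ r) ^ k = fps_of_poly N"
    using Suc.prems by (simp add: mult.assoc)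
  from Suc.IH[OF this] obtain w j0 where w:
    "\<And>j. j \<ge> j0 \<Longrightarrow> fps_nth (F * (1 - fps_X ^ r)) (i + j * r) = (\<Sum>l<k. w l * of_nat (j + l choose l))"
    by blast
  let ?u = "\<lambda>j. \<Sum>l<k. w l * of_nat (j + Suc l choose Suc l)"
  define K where "K = fps_nth F (i + j0 * r) - ?u j0"
  have "fps_nth F (i + j * r) = K + ?u j" if "j \<ge> j0" for j
    using that
  proof (induction j rule: dec_induct)
    case base
    then show ?case by (simp add: K_def)
  next
    case (step j)
    have "fps_nth (F * (1 - fps_X ^ r)) (i + Suc j * r) = fps_nth F (i + Suc j * r) - fps_nth F (i + j * r)"
      by (simp add: right_diff_distrib fps_X_power_mult_right_nth)
    then have "fps_nth F (i + Suc j * r) = fps_nth F (i + j * r) + (\<Sum>l<k. w l * of_nat (Suc j + l choose l))"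
      using w[of "Suc j"] step.hyps by (simp add: diff_eq_eq add.commute)
    also have "\<dots> = K + (?u j + (\<Sum>l<k. w l * of_nat (Suc j + l choose l)))"
      by (simp add: step.IH add.assoc)
    also have "?u j + (\<Sum>l<k. w l * of_nat (Suc j + l choose l)) = ?u (Suc j)"
      by (simp add: sum.distrib[symmetric] algebra_simps)
    finally show ?case .
  qed
  then have "\<forall>j\<ge>j0. fps_nth F (i + j * r) =
     (\<Sum>l<Suc k. (case l of 0 \<Rightarrow> K | Suc l \<Rightarrow> w l) * of_nat (j + l choose l))"
    by (simp add: sum.lessThan_Suc_shift del: sum.lessThan_Suc binomial_Suc_Suc)
  then show ?case by blast
qed

lemma binomial_eq_poly:
  "\<exists>p :: 'a :: field_char_0 poly. \<forall>j. poly p (of_nat j) = of_nat (j + l choose l)"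
proof (intro exI allI)
  fix j
  show "poly (Polynomial.smult (1 / fact l) (\<Prod>i=0..<l. [:of_nat l - of_nat i, 1:])) (of_nat j :: 'a) =
     of_nat (j + l choose l)"
    by (simp add: binomial_gbinomial gbinomial_prod_rev poly_prod algebra_simps)
qed

lemma rational_fps_coeff_eventually_poly:
  fixes F :: "'a :: field_char_0 fps"
  assumes "F * (1 - fps_X ^ r) ^ k = fps_of_poly N" "r > 0"
  shows "\<exists>p j0. \<forall>j\<ge>j0. fps_nth F (i + j * r) = poly p (of_nat j)"
proof -
  obtain w j0 where w: "\<forall>j\<ge>j0. fps_nth F (i + j * r) = (\<Sum>l<k. w l * of_nat (j + l choose l))"
    using rational_fps_coeff_eventually_binomial[OF assms] by blast
  obtain b :: "nat \<Rightarrow> 'a poly" where b: "\<And>l j. poly (b l) (of_nat j) = of_nat (j + l choose l)"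
    using binomial_eq_poly by metis
  have "\<forall>j\<ge>j0. fps_nth F (i + j * r) = poly (\<Sum>l<k. Polynomial.smult (w l) (b l)) (of_nat j)"
    using w by (simp add: poly_sum b)
  then show ?thesis by blast
qed

text \<open>Otherwise \<open>p - [:c:]\<close> would be a nonzero polynomial with infinitely many
  roots.\<close>

lemma poly_const_if_unbounded_value:
  fixes p :: "'a :: field_char_0 poly"
  assumes "\<And>k. \<exists>h\<ge>k. poly p (of_nat h) = c"
  shows "p = [:c:]"
proof (rule ccontr)
  assume "p \<noteq> [:c:]"
  then have "finite {x. poly (p - [:c:]) x = 0}" by (intro poly_roots_finite) simp
  then have "finite (of_nat -` {x. poly (p - [:c:]) x = 0} :: nat set)"
    by (intro finite_vimageI inj_of_nat)
  then obtain B where "\<And>h::nat. poly (p - [:c:]) (of_nat h) = 0 \<Longrightarrow> h \<le> B"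
    unfolding finite_nat_set_iff_bounded_le by auto
  with assms[of "Suc B"] show False by fastforce
qed


section \<open>Fixed rational power series: roots of the denominator and periodicity\<close>

lemma fixed_fps_iterate:
  fixes F :: "'a fps"
  assumes "\<And>n. fps_nth F (s * n + t) = fps_nth F n"
  shows "fps_nth F (s ^ k * n + t * (\<Sum>i<k. s ^ i)) = fps_nth F n"
proof (induction k)
  case (Suc k)
  have "t * (\<Sum>i<Suc k. s ^ i) = s * (t * (\<Sum>i<k. s ^ i)) + t"
    by (simp add: sum.lessThan_Suc_shift sum_distrib_left algebra_simps del: sum.lessThan_Suc)
  then show ?case
    using assms[of "s ^ k * n + t * (\<Sum>i<k. s ^ i)"] Suc
    by (simp add: algebra_simps del: sum.lessThan_Suc)
qed simp

lemma pcompose_power: "(p ^ n) \<circ>\<^sub>p q = (p \<circ>\<^sub>p q) ^ n" for p q :: "'a :: comm_ring_1 poly"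
  by (induction n) (simp_all add: pcompose_mult pcompose_1)

lemma fixed_rational_roots:
  fixes F :: "complex fps" and P Q :: "complex poly"
  assumes st: "t < s"
    and fixed: "section_fps s t F = F"
    and FQ: "F * fps_of_poly Q = fps_of_poly P" and cop: "coprime P Q" and Q0: "Q \<noteq> 0"
  shows "{z. poly Q z = 0} \<subseteq> (\<lambda>z. z ^ s) ` {z. poly Q z = 0}"
proof -
  define Z where "Z = {z. poly Q z = 0}"
  have fin: "finite Z" unfolding Z_def by (rule poly_roots_finite[OF Q0])
  define A where "A = (\<Prod>z\<in>Z. [:- (z ^ s), 1:])"
  define G where "G = A ^ Polynomial.degree Q"
  have A0: "poly A x = 0 \<longleftrightarrow> x \<in> (\<lambda>z. z ^ s) ` Z" for x
    using fin by (auto simp: A_def poly_prod)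
  have "\<forall>x. poly Q x = 0 \<longrightarrow> poly (A \<circ>\<^sub>p Polynomial.monom 1 s) x = 0"
    by (auto simp: poly_pcompose poly_monom A0 Z_def)
  \<comment> \<open>Multiplicities in \<open>Q\<close> are at most its degree, so this power of the
    radical-like \<open>A(x^s)\<close> absorbs them.\<close>
  then have "Q dvd (A \<circ>\<^sub>p Polynomial.monom 1 s) ^ Polynomial.degree Q"
    unfolding nullstellensatz_univariate using Q0 by simp
  also have "\<dots> = G \<circ>\<^sub>p Polynomial.monom 1 s"
    by (simp add: G_def pcompose_power)
  finally obtain N where N: "G \<circ>\<^sub>p Polynomial.monom 1 s = Q * N" by blast
  have "F * fps_of_poly (G \<circ>\<^sub>p Polynomial.monom 1 s) = fps_of_poly (P * N)"
    unfolding N fps_of_poly_mult by (simp add: mult.assoc[symmetric] FQ)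
  from arg_cong[OF this, of "section_fps s t"]
  have FG: "F * fps_of_poly G = section_fps s t (fps_of_poly (P * N))"
    using section_fps_mult[OF st, of F G] fixed by simp
  have "\<exists>M. section_fps s t (fps_of_poly (P * N)) = fps_of_poly M"
  proof
    have "Polynomial.coeff (P * N) (s * n + t) = 0" if "n > Polynomial.degree (P * N)" for n
    proof (rule coeff_eq_0)
      have "n \<le> s * n" using st by simp
      then show "Polynomial.degree (P * N) < s * n + t" using that by linarith
    qed
    \<comment> \<open>\<open>Abs_poly\<close> can be inverted only on sequences that are almost
      everywhere zero.\<close>
    then have "\<forall>\<^sub>\<infinity>n. Polynomial.coeff (P * N) (s * n + t) = 0"
      unfolding MOST_nat by blast
    then show "section_fps s t (fps_of_poly (P * N)) =
        fps_of_poly (Abs_poly (\<lambda>n. Polynomial.coeff (P * N) (s * n + t)))"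
      by (intro fps_ext) (simp add: section_fps_def Abs_poly_inverse)
  qed
  then obtain M where M: "F * fps_of_poly G = fps_of_poly M" using FG by metis
  \<comment> \<open>Both sides equal \<open>F\<close> times \<open>Q\<close> times \<open>G\<close>,
    so coprimality of \<open>P\<close> and \<open>Q\<close> will force \<open>Q\<close> to divide
    \<open>G\<close>.\<close>
  have "fps_of_poly (P * G) = fps_of_poly (M * Q)"
    by (simp add: fps_of_poly_mult M[symmetric] FQ[symmetric] mult_ac)
  then have "Q dvd P * G" by (simp add: fps_of_poly_eq_iff)
  then have "Q dvd G" using cop by (simp add: coprime_commute coprime_dvd_mult_right_iff)
  then have "poly G z = 0" if "poly Q z = 0" for z using that by (auto simp: dvd_def)
  then show ?thesis using A0 by (auto simp: G_def Z_def)
qed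

lemma fixed_rational_fps_periodic:
  fixes F :: "complex fps" and P Q :: "complex poly"
  assumes s: "s \<ge> 2" and t: "1 \<le> t" "t < s"
    and fixed: "\<And>n. fps_nth F (s * n + t) = fps_nth F n"
    and FQ: "F * fps_of_poly Q = fps_of_poly P" and cop: "coprime P Q" and Q0: "poly Q 0 \<noteq> 0"
  shows "\<exists>M\<ge>2. \<forall>n. fps_nth F (n + (\<Sum>i<M. s ^ i)) = fps_nth F n"
proof -
  define Z where "Z = {z. poly Q z = 0}"
  have [simp]: "Q \<noteq> 0" using Q0 by auto
  have fin: "finite Z" unfolding Z_def by (simp add: poly_roots_finite)
  have "section_fps s t F = F" by (rule fps_ext) (simp add: section_fps_def fixed)
  then have "Z \<subseteq> (\<lambda>z. z ^ s) ` Z"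
    unfolding Z_def using fixed_rational_roots t(2) FQ cop by simp
  \<comment> \<open>The image of the finite set \<open>Z\<close> has at most as many elements as
    \<open>Z\<close>, so the inclusion is an equality.\<close>
  then have "(\<lambda>z. z ^ s) ` Z = Z"
    using fin by (metis card_image_le card_seteq finite_imageI)
  then obtain m where m: "m > 0" "\<forall>z\<in>Z. ((\<lambda>z. z ^ s) ^^ m) z = z"
    using finite_surj_periodic[OF fin] by blast
  have "((\<lambda>z. z ^ s) ^^ k) z = z ^ (s ^ k)" for k and z :: complex
    by (induction k) (simp_all add: power_mult[symmetric] mult.commute)
  then have zm: "z ^ (s ^ m) = z" if "z \<in> Z" for z using m that by simp
  \<comment> \<open>Each root is nonzero with \<open>z ^ (s ^ m) = z\<close>, hence a
    \<open>d\<close>-th root of unity. Being one less than \<open>s ^ m\<close>, \<open>d\<close> is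
    coprime to \<open>s\<close>, as \<open>dvd_geometric_sum\<close> requires.\<close>
  define d where "d = s ^ m - 1"
  have sm: "s ^ m = Suc d" "d > 0"
    using s m one_less_power[of s m] by (auto simp: d_def)
  have zd: "z ^ d = 1" if "z \<in> Z" for z
  proof -
    have "z \<noteq> 0" using that Q0 by (auto simp: Z_def)
    then show ?thesis using zm[OF that] by (simp add: sm)
  qed
  have "coprime d (s ^ m)" by (simp add: sm)
  then have "coprime d s" using m by simp
  then obtain M where M: "M \<ge> 2" "d dvd (\<Sum>i<M. s ^ i)"
    using dvd_geometric_sum sm(2) s by blast
  define r where "r = (\<Sum>i<M. s ^ i)"
  have r: "r > 0" using M(1) s unfolding r_def by (intro sum_pos) (auto simp: lessThan_empty_iff)
  have zr: "z ^ r = 1" if "z \<in> Z" for z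
    using M(2) zd[OF that] unfolding r_def[symmetric] by (auto simp: power_mult)
  have "\<forall>x. poly Q x = 0 \<longrightarrow> poly (1 - Polynomial.monom 1 r) x = 0"
    using zr by (simp add: poly_monom Z_def)
  then have "Q dvd (1 - Polynomial.monom 1 r) ^ Polynomial.degree Q"
    unfolding nullstellensatz_univariate by simp
  then obtain N where N: "(1 - Polynomial.monom 1 r) ^ Polynomial.degree Q = Q * N" by blast
  have "F * (1 - fps_X ^ r) ^ Polynomial.degree Q = F * fps_of_poly (Q * N)"
    unfolding N[symmetric] by (simp add: fps_of_poly_power fps_of_poly_diff fps_of_poly_monom')
  also have "\<dots> = fps_of_poly (P * N)"
    unfolding fps_of_poly_mult by (simp add: mult.assoc[symmetric] FQ)
  finally have FN: "F * (1 - fps_X ^ r) ^ Polynomial.degree Q = fps_of_poly (P * N)" .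
  \<comment> \<open>The identity \<open>s ^ M = 1 + (s - 1) * r\<close> shows that the
    \<open>M\<close>-th iterate of the affine map moves \<open>n\<close> by a multiple of
    \<open>r\<close>.\<close>
  have step: "fps_nth F (n + ((s - 1) * n + t) * r) = fps_nth F n" for n
  proof -
    have "s ^ M * n + t * r = n + ((s - 1) * n + t) * r"
      using geometric_sum_nat[of s M] s by (simp add: r_def[symmetric] distrib_left distrib_right mult_ac)
    then show ?thesis using fixed_fps_iterate[of F s t M n, OF fixed] by (simp add: r_def)
  qed
  have unbounded: "\<exists>h\<ge>k. fps_nth F (n + h * r) = fps_nth F n" for n k
  proof (induction k)
    case (Suc k)
    then obtain h where h: "h \<ge> k" "fps_nth F (n + h * r) = fps_nth F n" by blast
    let ?e = "(s - 1) * (n + h * r) + t"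
    have "fps_nth F (n + (h + ?e) * r) = fps_nth F n"
      using step[of "n + h * r"] h by (simp add: distrib_right add.assoc)
    \<comment> \<open>Here \<open>1 \<le> t\<close> is essential: it makes the shift positive even
      for \<open>n = 0\<close>.\<close>
    moreover have "h + ?e \<ge> Suc k" using h t by simp
    ultimately show ?case by blast
  qed (auto intro: exI[of _ 0])
  have "fps_nth F (n + r) = fps_nth F n" for n
  proof -
    obtain p j0 where p: "\<And>j. j \<ge> j0 \<Longrightarrow> fps_nth F (n + j * r) = poly p (of_nat j)"
      using rational_fps_coeff_eventually_poly[OF FN r] by blast
    have "\<exists>h\<ge>k. poly p (of_nat h) = fps_nth F n" for k
      \<comment> \<open>The index must also pass \<open>j0\<close>, where the polynomial formula
        takes over.\<close>
      using unbounded[of "max k j0" n] p by (metis max.bounded_iff)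
    then have pc: "p = [:fps_nth F n:]" by (rule poly_const_if_unbounded_value)
    \<comment> \<open>Starting from \<open>n + r\<close>, the same class is met at index
      \<open>Suc h\<close>, so the constant \<open>p\<close> also gives the value at
      \<open>n + r\<close>.\<close>
    obtain h where "h \<ge> j0" "fps_nth F (n + r + h * r) = fps_nth F (n + r)"
      using unbounded by blast
    then show ?thesis using p[of "Suc h"] by (simp add: pc add.assoc)
  qed
  then show ?thesis using M(1) by (auto simp: r_def)
qed


section \<open>Laurent expansion as an injective linear map\<close>

lemma laurent_Fract_fps:
  assumes "F * fps_of_poly Q = fps_of_poly P" "Q \<noteq> 0"
  shows "laurent (Fract P Q) = fps_to_fls F"
proof -
  have "poly_to_fls P = fps_to_fls F * poly_to_fls Q"
    by (simp add: assms(1)[symmetric] fls_times_fps_to_fls)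
  then show ?thesis using assms(2) by (simp add: laurent_Fract)
qed

lemma laurent_add: "laurent (R + S) = laurent R + laurent S"
proof -
  obtain a b where R: "R = Fract a b" "b \<noteq> 0" by (cases R)
  obtain c d where S: "S = Fract c d" "d \<noteq> 0" by (cases S)
  show ?thesis using R S
    by (simp add: laurent_Fract fps_of_poly_add fps_of_poly_mult fls_times_fps_to_fls add_frac_eq mult_ac)
qed

lemma laurent_scale: "laurent (scale_ratfun c R) = fls_const c * laurent R"
proof -
  obtain a b where R: "R = Fract a b" "b \<noteq> 0" by (cases R)
  show ?thesis using R
    by (simp add: scale_ratfun_def to_fract_def laurent_Fract fps_of_poly_smult fls_times_fps_to_fls
          fps_of_poly_const)
qed

lemma laurent_eq_0_iff: "laurent R = 0 \<longleftrightarrow> R = 0"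
proof -
  obtain a b where R: "R = Fract a b" "b \<noteq> 0" by (cases R)
  then show ?thesis by (simp add: laurent_Fract Zero_fract_def eq_fract)
qed

lemma laurent_eq_iff: "laurent R = laurent S \<longleftrightarrow> R = S"
proof -
  have "laurent R = laurent (R - S) + laurent S" by (simp add: laurent_add[symmetric])
  then show ?thesis using laurent_eq_0_iff[of "R - S"] by simp
qed

lemma subspace_fixed: "ratfun.subspace {R. fixed_by_phi s t R}"
  by (rule ratfun.subspaceI)
     (auto simp: fixed_by_phi_def phi_def fun_eq_iff laurent_add laurent_scale
        laurent_eq_0_iff[THEN iffD2])

text \<open>The generating function of an \<open>r\<close>-periodic sequence on the naturals. Orbit
  functions and fixed functions are both brought to this form and compared there.\<close>

definition periodic_ratfun :: "int \<Rightarrow> (int \<Rightarrow> complex) \<Rightarrow> ratfun" where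
  "periodic_ratfun r f =
     Fract (\<Sum>j\<in>{0..<r}. Polynomial.monom (f j) (nat j)) (1 - Polynomial.monom 1 (nat r))"

lemma one_minus_monom_neq_0:
  assumes "r > 0"
  shows "1 - Polynomial.monom 1 r \<noteq> (0 :: complex poly)"
proof
  assume "1 - Polynomial.monom 1 r = (0 :: complex poly)"
  then have "Polynomial.coeff (1 - Polynomial.monom 1 r :: complex poly) 0 = 0" by simp
  then show False using assms by simp
qed

text \<open>Multiplication by \<open>1 - x^r\<close> cancels all but the first \<open>r\<close>
  coefficients. Periodicity is required only from 0 on, since the coefficients of a fixed function
  vanish at negative indices and are not periodic across 0.\<close>

lemma laurent_periodic_ratfun:
  assumes r: "r \<ge> 1" and f: "\<And>n. n \<ge> 0 \<Longrightarrow> f (n + r) = f n"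
  shows "fls_nth (laurent (periodic_ratfun r f)) n = (if n \<ge> 0 then f n else 0)"
proof -
  define F where "F = Abs_fps (\<lambda>k. f (int k))"
  let ?N = "\<Sum>j\<in>{0..<r}. Polynomial.monom (f j) (nat j)"
  have "Polynomial.coeff ?N k = (if int k < r then f (int k) else 0)" for k
  proof -
    have "Polynomial.coeff ?N k = (\<Sum>j\<in>{0..<r}. if j = int k then f j else 0)"
      unfolding coeff_sum by (intro sum.cong) auto
    then show ?thesis by simp
  qed
  moreover have "f (int k) = f (int (k - nat r))" if "\<not> k < nat r" for k
    using f[of "int (k - nat r)"] that r by simp
  ultimately have "F * fps_of_poly (1 - Polynomial.monom 1 (nat r)) = fps_of_poly ?N"
    by (intro fps_ext)
       (auto simp: F_def fps_of_poly_diff fps_of_poly_monom' right_diff_distrib fps_X_power_mult_right_nth)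
  then have "laurent (periodic_ratfun r f) = fps_to_fls F"
    unfolding periodic_ratfun_def using r by (intro laurent_Fract_fps one_minus_monom_neq_0) auto
  then show ?thesis by (simp add: F_def)
qed

lemma sum_Fract: "(\<Sum>i\<in>I. Fract (p i) q) = Fract (\<Sum>i\<in>I. p i) q" if "q \<noteq> 0"
proof -
  have "Fract (p + p') q = Fract p q + Fract p' q" for p p'
    using that by (simp add: eq_fract algebra_simps)
  then show ?thesis using that
    by (induction I rule: infinite_finite_induct) (simp_all add: Zero_fract_def eq_fract del: add_fract)
qed

section \<open>Multiplicative order, distinguished moduli and orbits\<close>

text \<open>Euler's theorem, transferred from the naturals, provides a positive exponent, so the
  least one defining \<open>ord\<close> is attained.\<close>

lemma int_ord:
  fixes r s :: int
  assumes "r \<ge> 2" "s \<ge> 0" "coprime r s"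
  shows "ord r s > 0" "[s ^ ord r s = 1] (mod r)"
proof -
  have "coprime (nat s) (nat r)"
    using assms by (simp add: coprime_commute coprime_int_iff[symmetric])
  then have "[nat s ^ totient (nat r) = 1] (mod nat r)" by (rule euler_theorem)
  then have "[int (nat s ^ totient (nat r)) = int 1] (mod int (nat r))" by (simp only: cong_int_iff)
  then have "totient (nat r) > 0 \<and> [s ^ totient (nat r) = 1] (mod r)"
    using assms by simp
  then have "ord r s > 0 \<and> [s ^ ord r s = 1] (mod r)"
    unfolding ord_def if_P[OF assms(3)] by (rule LeastI)
  then show "ord r s > 0" "[s ^ ord r s = 1] (mod r)" by auto
qed

lemma int_geometric_sum: "(s - 1) * (\<Sum>i<k. s ^ i) = s ^ k - 1" for s :: int
  by (simp add: power_diff_1_eq)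

lemma int_geometric_sum_div:
  fixes s :: int
  assumes "s \<ge> 2"
  shows "(s ^ k - 1) div (s - 1) = (\<Sum>i<k. s ^ i)"
  using assms by (simp flip: int_geometric_sum)

text \<open>With \<open>r\<close> the sum, \<open>r\<close> divides \<open>s ^ M - 1\<close>,
  whereas \<open>0 < s ^ d - 1 < r\<close> for \<open>0 < d < M\<close>; so the order of
  \<open>s\<close> is exactly \<open>M\<close>. The quotient in \<open>distinguished\<close> is then
  \<open>r\<close> itself.\<close>

lemma distinguished_geometric_sum:
  fixes s t :: int
  assumes s: "s \<ge> 2" and M: "M \<ge> 2"
  shows "distinguished s t (\<Sum>i<M. s ^ i)"
proof -
  define r where "r = (\<Sum>i<M. s ^ i)"
  obtain M' where M': "M = Suc M'" "M' > 0" using M by (cases M) auto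
  have "r = 1 + s * (\<Sum>i<M'. s ^ i)"
    by (simp add: r_def M' sum.lessThan_Suc_shift sum_distrib_left del: sum.lessThan_Suc)
  then have cop: "coprime r s"
    by (metis add.commute coprime_1_left coprime_commute coprime_iff_gcd_eq_1 gcd_add_mult mult.commute)
  have gt: "s ^ k - 1 < r" if "k < M" for k
  proof -
    have "s ^ k \<le> r" unfolding r_def using s that by (intro member_le_sum) auto
    then show ?thesis by simp
  qed
  have r2: "r \<ge> 2" using gt[of 1] s M by simp
  have "ord r s = (LEAST d. d > 0 \<and> [s ^ d = 1] (mod r))" using cop by (simp add: ord_def)
  also have "\<dots> = M"
  proof (rule Least_equality)
    have "r dvd s ^ M - 1" using int_geometric_sum[of s M] by (metis dvd_triv_right r_def)
    then show "0 < M \<and> [s ^ M = 1] (mod r)" using M by (simp add: cong_iff_dvd_diff)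
    fix d assume d: "0 < d \<and> [s ^ d = 1] (mod r)"
    have "s ^ d - 1 > 0" using d s by (simp add: one_less_power)
    moreover have "r dvd s ^ d - 1" using d by (simp add: cong_iff_dvd_diff)
    ultimately have "r \<le> s ^ d - 1" by (intro zdvd_imp_le)
    then show "M \<le> d" using gt[of d] by linarith
  qed
  finally show ?thesis
    unfolding distinguished_def r_def[symmetric]
    using cop r2 int_geometric_sum_div[OF s, of M] by (simp add: r_def)
qed

lemma rho_mod: "rho s t r (n mod r) = (s * n + t) mod r"
  unfolding rho_def by (metis mod_add_left_eq mod_mult_right_eq)

lemma funpow_rho:
  assumes "0 \<le> n" "n < r"
  shows "(rho s t r ^^ k) n = (s ^ k * n + t * (\<Sum>i<k. s ^ i)) mod r"
proof (induction k)
  case (Suc k)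
  have "t * (\<Sum>i<Suc k. s ^ i) = s * (t * (\<Sum>i<k. s ^ i)) + t"
    by (simp add: sum.lessThan_Suc_shift sum_distrib_left algebra_simps del: sum.lessThan_Suc)
  then have "s ^ Suc k * n + t * (\<Sum>i<Suc k. s ^ i) = s * (s ^ k * n + t * (\<Sum>i<k. s ^ i)) + t"
    by (simp add: algebra_simps del: sum.lessThan_Suc)
  then show ?case
    by (simp add: Suc rho_mod del: sum.lessThan_Suc power_Suc)
qed (use assms in simp)

text \<open>This is the purpose of the divisibility in \<open>distinguished\<close>: after
  \<open>ord r s\<close> steps the linear factor is 1 and the translation part is 0 modulo
  \<open>r\<close>.\<close>

lemma rho_funpow_ord:
  assumes "s \<ge> 2" "distinguished s t r" "n \<in> {0..<r}"
  shows "(rho s t r ^^ ord r s) n = n"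
proof -
  have r: "r \<ge> 2" "coprime r s" "r dvd t * (\<Sum>i<ord r s. s ^ i)"
    using assms by (auto simp: distinguished_def int_geometric_sum_div)
  have "[s ^ ord r s * n + t * (\<Sum>i<ord r s. s ^ i) = 1 * n + 0] (mod r)"
    using int_ord(2)[OF r(1) _ r(2)] assms(1) r(3) by (intro cong_add cong_mult) (auto simp: cong_0_iff)
  then show ?thesis using assms(3) by (simp add: funpow_rho cong_def)
qed

text \<open>On residues the inverse of \<open>rho\<close> is its iterate of exponent
  \<open>ord r s - 1\<close>, so negative iterates add nothing to the forward orbit.\<close>

lemma orbit_set_eq:
  assumes s: "s \<ge> 2" and d: "distinguished s t r" and n: "n \<in> {0..<r}"
  shows "orbit_set s t r n = range (\<lambda>k. (rho s t r ^^ k) n)"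
proof -
  let ?\<rho> = "rho s t r" and ?M = "ord r s"
  have r: "r \<ge> 2" "coprime r s" using d by (auto simp: distinguished_def)
  have M: "?M > 0" using int_ord r s by simp
  have bij: "bij_betw ?\<rho> {0..<r} {0..<r}" using bij_betw_rho r by simp
  have mem: "(?\<rho> ^^ k) x \<in> {0..<r}" if "x \<in> {0..<r}" for k x
    using that r by (simp add: funpow_rho)
  have inv: "inv_into {0..<r} ?\<rho> x = (?\<rho> ^^ (?M - 1)) x" if "x \<in> {0..<r}" for x
  proof (rule inv_into_f_eq)
    show "inj_on ?\<rho> {0..<r}" using bij by (simp add: bij_betw_def)
    have "?\<rho> ((?\<rho> ^^ (?M - 1)) x) = (?\<rho> ^^ Suc (?M - 1)) x" by simp
    also have "\<dots> = x" using M rho_funpow_ord[OF s d that] by simp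
    finally show "?\<rho> ((?\<rho> ^^ (?M - 1)) x) = x" .
  qed (use mem that in blast)
  have "(inv_into {0..<r} ?\<rho> ^^ k) n = (?\<rho> ^^ ((?M - 1) * k)) n" for k
  proof (induction k)
    case (Suc k)
    then show ?case using inv[OF mem[OF n]] by (simp add: funpow_add)
  qed simp
  then have "rho_iter s t r i n \<in> range (\<lambda>k. (?\<rho> ^^ k) n)" for i
    by (simp add: rho_iter_def)
  moreover have "(?\<rho> ^^ k) n = rho_iter s t r (int k) n" for k by (simp add: rho_iter_def)
  ultimately show ?thesis unfolding orbit_set_def by blast
qed

lemma orbit_set_subset:
  assumes "s \<ge> 2" "distinguished s t r" "n \<in> {0..<r}"
  shows "orbit_set s t r n \<subseteq> {0..<r}"
  using assms by (auto simp: orbit_set_eq funpow_rho)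

lemma orbit_set_self:
  assumes "s \<ge> 2" "distinguished s t r" "n \<in> {0..<r}"
  shows "n \<in> orbit_set s t r n"
  using assms by (auto simp: orbit_set_eq intro: image_eqI[of _ _ 0])

lemma orbit_set_eq_if_mem:
  assumes s: "s \<ge> 2" and d: "distinguished s t r" and n: "n \<in> {0..<r}" and m: "m \<in> orbit_set s t r n"
  shows "orbit_set s t r m = orbit_set s t r n"
proof -
  let ?\<rho> = "rho s t r" and ?M = "ord r s"
  have M: "?M > 0" using int_ord d s by (simp add: distinguished_def)
  have m': "m \<in> {0..<r}" using orbit_set_subset assms by blast
  obtain k where k: "m = (?\<rho> ^^ k) n" using m orbit_set_eq[OF s d n] by blast
  have per: "(?\<rho> ^^ (?M * j)) n = n" for j
    using rho_funpow_ord[OF s d n] by (induction j) (simp_all add: funpow_add)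
  \<comment> \<open>Going on from \<open>m\<close> for \<open>?M * k - k\<close> steps completes
    \<open>k\<close> full periods from \<open>n\<close>; the subtraction is not truncated because
    \<open>?M > 0\<close>.\<close>
  have "(?\<rho> ^^ (?M * k - k)) m = (?\<rho> ^^ (?M * k - k + k)) n" unfolding k funpow_add by simp
  also have "\<dots> = n" using M per[of k] by simp
  finally have n_m: "n = (?\<rho> ^^ (?M * k - k)) m" ..
  have sub: "range (\<lambda>i. (?\<rho> ^^ i) ((?\<rho> ^^ l) x)) \<subseteq> range (\<lambda>i. (?\<rho> ^^ i) x)" for l x
  proof (rule image_subsetI)
    fix i
    have "(?\<rho> ^^ i) ((?\<rho> ^^ l) x) = (?\<rho> ^^ (i + l)) x" by (simp add: funpow_add)
    then show "(?\<rho> ^^ i) ((?\<rho> ^^ l) x) \<in> range (\<lambda>i. (?\<rho> ^^ i) x)" by blast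
  qed
  show ?thesis
    unfolding orbit_set_eq[OF s d n] orbit_set_eq[OF s d m']
    using sub[of k n, folded k] sub[of "?M * k - k" m, folded n_m] by (rule subset_antisym)
qed


lemma rho_mem_orbit_set_iff:
  assumes s: "s \<ge> 2" and d: "distinguished s t r" and n: "n \<in> {0..<r}" and x: "x \<in> {0..<r}"
  shows "rho s t r x \<in> orbit_set s t r n \<longleftrightarrow> x \<in> orbit_set s t r n"
proof -
  have "rho s t r x \<in> orbit_set s t r x"
    unfolding orbit_set_eq[OF s d x] by (rule image_eqI[of _ _ 1]) auto
  then show ?thesis
    by (metis orbit_set_eq_if_mem[OF s d] orbit_set_self[OF s d] n x)
qed

lemma orbit_fun_eq_periodic_ratfun:
  assumes "s \<ge> 2" "distinguished s t r" "n \<in> {0..<r}"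
  shows "orbit_fun s t r n = periodic_ratfun r (\<lambda>j. if j mod r \<in> orbit_set s t r n then 1 else 0)"
proof -
  have "(\<Sum>j\<in>orbit_set s t r n. Polynomial.monom 1 (nat j)) =
    (\<Sum>j\<in>{0..<r}. Polynomial.monom (if j mod r \<in> orbit_set s t r n then 1 else 0 :: complex) (nat j))"
    using orbit_set_subset[OF assms] by (intro sum.mono_neutral_cong_left) (auto)
  then show ?thesis by (simp only: orbit_fun_def periodic_ratfun_def)
qed

section \<open>Fixed rational functions as periodic generating functions\<close>

text \<open>The bound \<open>t \<le> s - 2\<close> enters here: \<open>(s - 1) * n\<close> is at
  most \<open>1 - s\<close>, which outweighs \<open>t\<close>.\<close>

lemma affine_neg_less:
  fixes s t n :: int
  assumes "s \<ge> 2" "t \<le> s - 2" "n < 0"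
  shows "s * n + t < n"
proof -
  have "(s - 1) * n \<le> (s - 1) * (-1)" using assms by (intro mult_left_mono) auto
  then show ?thesis using assms by (simp add: algebra_simps)
qed

lemma fixed_orbit_fun:
  assumes s: "s \<ge> 2" and t: "1 \<le> t" "t \<le> s - 2" and d: "distinguished s t r" and n: "n \<in> {0..<r}"
  shows "fixed_by_phi s t (orbit_fun s t r n)"
proof -
  let ?f = "\<lambda>j. if j mod r \<in> orbit_set s t r n then 1 else 0 :: complex"
  have r: "r \<ge> 2" using d by (simp add: distinguished_def)
  have L: "fls_nth (laurent (orbit_fun s t r n)) k = (if k \<ge> 0 then ?f k else 0)" for k
    unfolding orbit_fun_eq_periodic_ratfun[OF s d n] using r by (subst laurent_periodic_ratfun) auto
  have "?f (s * k + t) = ?f k" for k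
    using rho_mem_orbit_set_iff[OF s d n, of "k mod r"] r by (simp add: rho_mod)
  \<comment> \<open>The affine map preserves the sign of the index, so the cut-off at 0 is
    respected.\<close>
  moreover have "s * k + t \<ge> 0 \<longleftrightarrow> k \<ge> 0" for k
    using affine_neg_less[of s t k] s t by (cases "k \<ge> 0") auto
  ultimately show ?thesis unfolding fixed_by_phi_def phi_def L by (simp add: fun_eq_iff)
qed

lemma fixed_coeff_neg:
  assumes s: "s \<ge> 2" and t: "t \<le> s - 2" and fixed: "fixed_by_phi s t R" and n: "n < 0"
  shows "fls_nth (laurent R) n = 0"
proof -
  \<comment> \<open>Induction on a bound \<open>k\<close> for the height of \<open>n\<close> above
    the subdegree; each application of the affine map lowers a negative index strictly.\<close>
  have "fls_nth (laurent R) n = 0" if "n < fls_subdegree (laurent R) + int k" "n < 0" for k n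
    using that
  proof (induction k arbitrary: n)
    case (Suc k)
    have "s * n + t < n" using affine_neg_less s t Suc.prems by simp
    then have "fls_nth (laurent R) (s * n + t) = 0" using Suc by simp
    moreover have "fls_nth (laurent R) (s * n + t) = fls_nth (laurent R) n"
      using fixed by (simp add: fixed_by_phi_def phi_def fun_eq_iff)
    ultimately show ?case by simp
  qed simp
  from this[of n "nat (n + 1 - fls_subdegree (laurent R))"] n show ?thesis by simp
qed

lemma fixed_eq_periodic_ratfun:
  assumes s: "s \<ge> 2" and t: "1 \<le> t" "t \<le> s - 2" and fixed: "fixed_by_phi s t R"
  defines "a \<equiv> fls_nth (laurent R)"
  obtains r where "distinguished s t r" "\<And>n. n \<ge> 0 \<Longrightarrow> a (n mod r) = a n" "R = periodic_ratfun r a"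
proof -
  define P Q where "P = fst (quot_of_fract R)" and "Q = snd (quot_of_fract R)"
  define F where "F = fls_regpart (laurent R)"
  have Q: "Q \<noteq> 0" and cop: "coprime P Q" and R: "R = Fract P Q"
    by (simp_all add: P_def Q_def coprime_quot_of_fract Fract_quot_of_fract)
  have neg: "a n = 0" if "n < 0" for n
    unfolding a_def using fixed_coeff_neg[OF s t(2) fixed that] .
  have LF: "laurent R = fps_to_fls F"
    using neg by (intro fls_eqI) (auto simp: F_def a_def)
  have F: "fps_nth F n = a (int n)" for n by (simp add: a_def LF)
  have "poly_to_fls P = fps_to_fls F * poly_to_fls Q"
    using Q by (simp add: LF[symmetric] R laurent_Fract)
  then have FQ: "F * fps_of_poly Q = fps_of_poly P"
    by (metis fls_times_fps_to_fls fps_to_fls_eq_iff)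
  have Q0: "poly Q 0 \<noteq> 0"
  proof
    assume "poly Q 0 = 0"
    \<comment> \<open>Since \<open>F\<close> has no negative powers, comparing constant terms in
      \<open>FQ\<close> gives \<open>P\<close> the root 0 as well, against coprimality.\<close>
    moreover have "poly P 0 = 0"
      using arg_cong[OF FQ, of "\<lambda>f. fps_nth f 0"] \<open>poly Q 0 = 0\<close> by (simp add: poly_0_coeff_0)
    ultimately show False
      using cop by (metis coprime_poly_0)
  qed
  define s' t' where "s' = nat s" and "t' = nat t"
  have st': "s = int s'" "t = int t'" using s t by (simp_all add: s'_def t'_def)
  have "fps_nth F (s' * n + t') = fps_nth F n" for n
    using fixed unfolding fixed_by_phi_def phi_def F a_def by (simp add: st' fun_eq_iff)
  from fixed_rational_fps_periodic[OF _ _ _ this FQ cop Q0] s t st'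
  obtain M where M: "M \<ge> 2" "\<And>n. fps_nth F (n + (\<Sum>i<M. s' ^ i)) = fps_nth F n" by auto
  define r where "r = (\<Sum>i<M. s ^ i)"
  have dist: "distinguished s t r" unfolding r_def by (rule distinguished_geometric_sum[OF s M(1)])
  then have r: "r \<ge> 2" by (simp add: distinguished_def)
  have per: "a (n + r) = a n" if "n \<ge> 0" for n
  proof -
    have "n + r = int (nat n + (\<Sum>i<M. s' ^ i))" using that by (simp add: r_def st')
    then show ?thesis using M(2)[of "nat n"] that by (simp add: F)
  qed
  have mult: "a (n + int k * r) = a n" if "n \<ge> 0" for n k
  proof (induction k)
    case (Suc k)
    have "n + int (Suc k) * r = n + int k * r + r" by (simp add: algebra_simps)
    then show ?case using per[of "n + int k * r"] Suc that r by (simp add: add.assoc)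
  qed simp
  have "a (n mod r) = a n" if "n \<ge> 0" for n
    using mult[of "n mod r" "nat (n div r)"] that r by (simp add: pos_imp_zdiv_nonneg_iff)
  moreover have "R = periodic_ratfun r a"
    unfolding laurent_eq_iff[symmetric] using r per neg
    by (intro fls_eqI) (simp add: laurent_periodic_ratfun flip: a_def)
  ultimately show ?thesis using that dist by blast
qed

section \<open>Decomposition into orbit functions\<close>

lemma smult_sum_right: "Polynomial.smult c (\<Sum>i\<in>I. f i) = (\<Sum>i\<in>I. Polynomial.smult c (f i))"
  by (induction I rule: infinite_finite_induct) (simp_all add: smult_add_right)

text \<open>Invariance makes \<open>a\<close> constant on orbits, and the orbits of \<open>U\<close>
  partition the residues; so the numerator splits into one scaled block per representative.\<close>

lemma periodic_ratfun_eq_sum_orbit_fun: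
  assumes s: "s \<ge> 2" and d: "distinguished s t r" and U: "orbit_reps s t r U"
    and a: "\<And>n. n \<in> {0..<r} \<Longrightarrow> a (rho s t r n) = a n"
  shows "periodic_ratfun r a = (\<Sum>n\<in>U. scale_ratfun (a n) (orbit_fun s t r n))"
proof -
  let ?O = "orbit_set s t r"
  have r: "r \<ge> 2" using d by (simp add: distinguished_def)
  have Usub: "U \<subseteq> {0..<r}" using U by (simp add: orbit_reps_def)
  then have finU: "finite U" by (rule finite_subset) simp
  have const: "a m = a n" if "n \<in> {0..<r}" "m \<in> ?O n" for m n
  proof -
    have "a ((rho s t r ^^ k) n) = a n" for k
    proof (induction k)
      case (Suc k)
      have "(rho s t r ^^ k) n \<in> {0..<r}" using that(1) r by (simp add: funpow_rho)
      then show ?case using a Suc by simp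
    qed simp
    then show ?thesis using that orbit_set_eq[OF s d that(1)] by auto
  qed
  have fin: "\<forall>n\<in>U. finite (?O n)"
    using orbit_set_subset[OF s d] Usub by (meson finite_atLeastLessThan_int finite_subset subsetD)
  have disj: "\<forall>n\<in>U. \<forall>m\<in>U. n \<noteq> m \<longrightarrow> ?O n \<inter> ?O m = {}"
  proof (intro ballI impI equals0I)
    fix n m j assume nm: "n \<in> U" "m \<in> U" "n \<noteq> m" "j \<in> ?O n \<inter> ?O m"
    then have "?O n = ?O j" "?O m = ?O j" using orbit_set_eq_if_mem[OF s d] Usub by blast+
    then show False using U nm Usub unfolding orbit_reps_def by (metis subsetD)
  qed
  have "{0..<r} = (\<Union>n\<in>U. ?O n)"
  proof
    show "(\<Union>n\<in>U. ?O n) \<subseteq> {0..<r}" using orbit_set_subset[OF s d] Usub by blast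
    show "{0..<r} \<subseteq> (\<Union>n\<in>U. ?O n)"
      using U orbit_set_self[OF s d] unfolding orbit_reps_def by blast
  qed
  then have "(\<Sum>j\<in>{0..<r}. Polynomial.monom (a j) (nat j)) =
      (\<Sum>n\<in>U. \<Sum>j\<in>?O n. Polynomial.monom (a j) (nat j))"
    using sum.UNION_disjoint[OF finU fin disj] by simp
  also have "\<dots> = (\<Sum>n\<in>U. Polynomial.smult (a n) (\<Sum>j\<in>?O n. Polynomial.monom 1 (nat j)))"
    using const Usub by (intro sum.cong refl) (auto simp: smult_sum_right smult_monom intro!: sum.cong)
  finally have N: "(\<Sum>j\<in>{0..<r}. Polynomial.monom (a j) (nat j)) = \<dots>" .
  have q: "1 - Polynomial.monom 1 (nat r) \<noteq> (0 :: complex poly)"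
    using r by (intro one_minus_monom_neq_0) simp
  show ?thesis
    unfolding periodic_ratfun_def N orbit_fun_def
    by (simp add: sum_Fract[OF q] scale_ratfun_def to_fract_def)
qed

theorem theorem4p1:
  fixes s t :: int and Ups :: "int \<Rightarrow> int set"
  assumes "s \<ge> 2" and "1 \<le> t" and "t \<le> s - 2"
    and "\<And>r. distinguished s t r \<Longrightarrow> orbit_reps s t r (Ups r)"
  shows "ratfun.span {orbit_fun s t r n | r n. distinguished s t r \<and> n \<in> Ups r} =
    {R. fixed_by_phi s t R}"
proof
  let ?B = "{orbit_fun s t r n | r n. distinguished s t r \<and> n \<in> Ups r}"
  have "?B \<subseteq> {R. fixed_by_phi s t R}"
    using fixed_orbit_fun[OF assms(1-3)] assms(4) unfolding orbit_reps_def by blast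
  then show "ratfun.span ?B \<subseteq> {R. fixed_by_phi s t R}"
    by (rule ratfun.span_minimal) (rule subspace_fixed)
  show "{R. fixed_by_phi s t R} \<subseteq> ratfun.span ?B"
  proof
    fix R assume "R \<in> {R. fixed_by_phi s t R}"
    then have fixed: "fixed_by_phi s t R" by simp
    define a where "a = fls_nth (laurent R)"
    obtain r where r: "distinguished s t r" "\<And>n. n \<ge> 0 \<Longrightarrow> a (n mod r) = a n" "R = periodic_ratfun r a"
      using fixed_eq_periodic_ratfun[OF assms(1-3) fixed] unfolding a_def by blast
    have "a (rho s t r n) = a n" if "n \<in> {0..<r}" for n
    proof -
      \<comment> \<open>Reduction modulo \<open>r\<close> is harmless only at nonnegative arguments;
        \<open>n \<ge> 0\<close> and \<open>t \<ge> 1\<close> ensure this for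
        \<open>s * n + t\<close>.\<close>
      have "a (rho s t r n) = a (s * n + t)" using that assms(1,2) r(2) by (simp add: rho_def)
      also have "\<dots> = a n" using fixed by (simp add: fixed_by_phi_def phi_def a_def fun_eq_iff)
      finally show ?thesis .
    qed
    then have "R = (\<Sum>n\<in>Ups r. scale_ratfun (a n) (orbit_fun s t r n))"
      using periodic_ratfun_eq_sum_orbit_fun assms(1,4) r by metis
    also have "\<dots> \<in> ratfun.span ?B"
      using r(1) by (intro ratfun.span_sum ratfun.span_scale ratfun.span_base) blast
    finally show "R \<in> ratfun.span ?B" .
  qed
qed

end
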